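(* Let $G$ be a graph and let $H$ be a rooted graph with root $r_H \in V(H)$. Then \[ b(G \,\square\, H) \le b(G \circ H) \le b(G) + \operatorname{ecc}(r_H). \]
   Context: All graphs are finite. For a graph $G$, $d(u,v)$ is graph distance and $B(v,r)=\{u\in V(G): d(u,v)\le r\}$. The burning number is $b(G)=\min\{k : \exists v_1,\dots,v_k\in V(G) \text{ with } V(G)=\bigcup_{i=1}^k B(v_i,k-i)\}$; equivalently, it is the minimum number of rounds needed to burn all vertices when in each round every burning vertex spreads fire to all its neighbors and one new fire may be started at an unburned vertex. $G\,\square\,H$ denotes the Cartesian product. For a rooted graph $H$ with root $r_H$, the rooted product $G\circ H$ is obtained by taking one copy of $G$ and, for each $v\in V(G)$, attaching a separate copy of $H$ by identifying $v$ with the root $r_H$ of that copy. The eccentricity of a vertex $v$ of $H$ is $\operatorname{ecc}(v)=\max_{u\in V(H)} d(u,v)$. *)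

theory Defs
  imports "Graph_Theory.Pair_Digraph" "HOL-Library.Extended_Nat"
begin

text \<open>
  Finite simple graphs are the library's \<open>pair_graph\<close>s: finite, loop-free, symmetric digraphs
  without parallel arcs. Connectedness is not assumed, so distances take values in \<open>enat\<close>.
\<close>

definition gdist :: "'a pair_pre_digraph \<Rightarrow> 'a \<Rightarrow> 'a \<Rightarrow> enat" where
  "gdist G u v = (INF p \<in> {p. pre_digraph.awalk (with_proj G) u p v}. enat (length p))"

definition gball :: "'a pair_pre_digraph \<Rightarrow> 'a \<Rightarrow> nat \<Rightarrow> 'a set" where
  "gball G v r = {u \<in> pverts G. gdist G u v \<le> enat r}"

definition ecc :: "'a pair_pre_digraph \<Rightarrow> 'a \<Rightarrow> enat" where
  "ecc G v = Max ((\<lambda>u. gdist G u v) ` pverts G)"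

definition burns_in :: "'a pair_pre_digraph \<Rightarrow> nat \<Rightarrow> bool" where
  "burns_in G k \<longleftrightarrow>
     (\<exists>v :: nat \<Rightarrow> 'a. (\<forall>i\<in>{1..k}. v i \<in> pverts G) \<and>
        pverts G = (\<Union>i\<in>{1..k}. gball G (v i) (k - i)))"

definition burning_number :: "'a pair_pre_digraph \<Rightarrow> nat" where
  "burning_number G = (LEAST k. burns_in G k)"

definition cartesian_product ::
  "'a pair_pre_digraph \<Rightarrow> 'b pair_pre_digraph \<Rightarrow> ('a \<times> 'b) pair_pre_digraph" where
  "cartesian_product G H =
     \<lparr> pverts = pverts G \<times> pverts H,
       parcs = {((g, h), (g', h')) | g h g' h'.
                  (g = g' \<and> g \<in> pverts G \<and> (h, h') \<in> parcs H) \<or>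
                  (h = h' \<and> h \<in> pverts H \<and> (g, g') \<in> parcs G)} \<rparr>"

text \<open>
  In the rooted product, \<open>(g, h)\<close> is the vertex \<open>h\<close> in the copy of \<open>H\<close> attached at \<open>g\<close>.
  The vertex \<open>g\<close> of \<open>G\<close> is identified with the root \<open>(g, r)\<close> of that copy.
\<close>

definition rooted_product ::
  "'a pair_pre_digraph \<Rightarrow> 'b pair_pre_digraph \<Rightarrow> 'b \<Rightarrow> ('a \<times> 'b) pair_pre_digraph" where
  "rooted_product G H r =
     \<lparr> pverts = pverts G \<times> pverts H,
       parcs = {((g, r), (g', r)) | g g'. (g, g') \<in> parcs G} \<union>
               {((g, h), (g, h')) | g h h'. g \<in> pverts G \<and> (h, h') \<in> parcs H} \<rparr>"

lemma gdist_self: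
  assumes "u \<in> pverts G"
  shows "gdist G u u = 0"
proof -
  have "pre_digraph.awalk (with_proj G) u [] u"
    using assms by (simp add: pre_digraph.awalk_def pre_digraph.cas.simps)
  then have "gdist G u u \<le> enat (length ([] :: ('a \<times> 'a) list))"
    unfolding gdist_def by (intro INF_lower) simp
  then show ?thesis by (simp add: zero_enat_def[symmetric])
qed

lemma burns_in_card:
  assumes "finite (pverts G)"
  shows "burns_in G (card (pverts G))"
proof -
  obtain v where v: "bij_betw v {1..card (pverts G)} (pverts G)"
    using ex_bij_betw_nat_finite_1[OF assms] by blast
  have img: "v ` {1..card (pverts G)} = pverts G"
    using v by (rule bij_betw_imp_surj_on)
  have "pverts G \<subseteq> (\<Union>i\<in>{1..card (pverts G)}. gball G (v i) (card (pverts G) - i))"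
  proof
    fix u
    assume u: "u \<in> pverts G"
    then obtain i where i: "i \<in> {1..card (pverts G)}" "u = v i"
      using img by blast
    have "u \<in> gball G (v i) (card (pverts G) - i)"
      using u gdist_self[OF u] by (simp add: gball_def i(2)[symmetric])
    with i(1) show "u \<in> (\<Union>i\<in>{1..card (pverts G)}. gball G (v i) (card (pverts G) - i))"
      by blast
  qed
  moreover have "(\<Union>i\<in>{1..card (pverts G)}. gball G (v i) (card (pverts G) - i)) \<subseteq> pverts G"
    by (auto simp: gball_def)
  moreover have "\<forall>i\<in>{1..card (pverts G)}. v i \<in> pverts G"
    using img by blast
  ultimately show ?thesis
    unfolding burns_in_def by blast
qed

lemma burns_in_burning_number:
  assumes "finite (pverts G)"
  shows "burns_in G (burning_number G)"
  unfolding burning_number_def by (rule LeastI, rule burns_in_card[OF assms])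

lemma pair_graph_cartesian_product:
  assumes "pair_graph G" "pair_graph H"
  shows "pair_graph (cartesian_product G H)"
proof -
  interpret G: pair_graph G by fact
  interpret H: pair_graph H by fact
  let ?P = "cartesian_product G H"
  have sub: "parcs ?P \<subseteq> pverts ?P \<times> pverts ?P"
    by (auto simp: cartesian_product_def dest: G.wellformed' H.wellformed')
  have fin: "finite (pverts ?P)"
    by (simp add: cartesian_product_def G.pair_finite_verts H.pair_finite_verts)
  show ?thesis
  proof
    show "finite (parcs ?P)"
      by (rule finite_subset[OF sub finite_cartesian_product[OF fin fin]])
    show "symmetric (with_proj ?P)"
      using G.arcs_symmetric H.arcs_symmetric
      by (simp add: symmetric_def sym_def cartesian_product_def) blast
    show "fst e \<noteq> snd e" if "e \<in> parcs ?P" for e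
      using that by (auto simp: cartesian_product_def dest: G.no_loops' H.no_loops')
  qed (use sub fin in auto)
qed

lemma pair_graph_rooted_product:
  assumes "pair_graph G" "pair_graph H" "r \<in> pverts H"
  shows "pair_graph (rooted_product G H r)"
proof -
  interpret G: pair_graph G by fact
  interpret H: pair_graph H by fact
  let ?P = "rooted_product G H r"
  have sub: "parcs ?P \<subseteq> pverts ?P \<times> pverts ?P"
    using assms(3) by (auto simp: rooted_product_def dest: G.wellformed' H.wellformed')
  have fin: "finite (pverts ?P)"
    by (simp add: rooted_product_def G.pair_finite_verts H.pair_finite_verts)
  show ?thesis
  proof
    show "finite (parcs ?P)"
      by (rule finite_subset[OF sub finite_cartesian_product[OF fin fin]])
    show "symmetric (with_proj ?P)"
      using G.arcs_symmetric H.arcs_symmetric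
      by (simp add: symmetric_def sym_def rooted_product_def)
    show "fst e \<noteq> snd e" if "e \<in> parcs ?P" for e
      using that by (auto simp: rooted_product_def dest: G.no_loops' H.no_loops')
  qed (use sub fin in auto)
qed

end

theory Submission
  imports Defs
begin

text \<open>
  Homomorphisms do not increase distances. Hence the image of a burning sequence of \<open>G\<close> under a
  homomorphism to \<open>H\<close> burns, after \<open>e\<close> further rounds, every vertex of \<open>H\<close> within distance \<open>e\<close> of
  the image of \<open>G\<close>. Both inequalities are instances: the rooted product is a spanning subgraph of
  the Cartesian product (\<open>e = 0\<close>), and every vertex of the rooted product is within distance
  \<open>ecc(r)\<close> of the embedded copy of \<open>G\<close>.
\<close>

definition digraph_hom :: "'a pair_pre_digraph \<Rightarrow> 'b pair_pre_digraph \<Rightarrow> ('a \<Rightarrow> 'b) \<Rightarrow> bool" where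
  "digraph_hom G H f \<longleftrightarrow> f ` pverts G \<subseteq> pverts H \<and> map_prod f f ` parcs G \<subseteq> parcs H"

lemma cas_hom:
  assumes "pre_digraph.cas (with_proj G) u p v"
  shows "pre_digraph.cas (with_proj H) (f u) (map (map_prod f f) p) (f v)"
  using assms by (induction p arbitrary: u) (auto simp: pre_digraph.cas.simps)

lemma awalk_hom:
  assumes "digraph_hom G H f" "pre_digraph.awalk (with_proj G) u p v"
  shows "pre_digraph.awalk (with_proj H) (f u) (map (map_prod f f) p) (f v)"
  using assms cas_hom[of G u p v H f] by (auto simp: pre_digraph.awalk_def digraph_hom_def)

lemma gdist_le_length: "pre_digraph.awalk (with_proj G) u p v \<Longrightarrow> gdist G u v \<le> enat (length p)"
  unfolding gdist_def by (intro INF_lower) simp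

lemma gdist_attained:
  assumes "gdist G u v = enat n"
  obtains p where "pre_digraph.awalk (with_proj G) u p v" "length p = n"
proof -
  let ?lengths = "(\<lambda>p. enat (length p)) ` {p. pre_digraph.awalk (with_proj G) u p v}"
  have "?lengths \<noteq> {}"
  proof
    assume "?lengths = {}"
    then have "gdist G u v = \<infinity>"
      unfolding gdist_def by (metis Inf_empty top_enat_def)
    then show False
      using assms by simp
  qed
  then have "Inf ?lengths \<in> ?lengths"
    by (meson ex_in_conv wellorder_InfI)
  then show thesis
    using assms that by (auto simp: gdist_def)
qed

lemma gdist_hom_le:
  assumes "digraph_hom G H f"
  shows "gdist H (f u) (f v) \<le> gdist G u v"
proof (cases "gdist G u v")
  case (enat n)
  then obtain p where "pre_digraph.awalk (with_proj G) u p v" "length p = n"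
    by (rule gdist_attained)
  then show ?thesis
    using gdist_le_length[OF awalk_hom[OF assms]] enat by fastforce
qed simp

lemma gdist_triangle:
  assumes "pair_wf_digraph G"
  shows "gdist G u w \<le> gdist G u v + gdist G v w"
proof (cases "gdist G u v"; cases "gdist G v w")
  fix m n
  assume dist: "gdist G u v = enat m" "gdist G v w = enat n"
  interpret pair_wf_digraph G by fact
  obtain p q where "awalk u p v" "length p = m" "awalk v q w" "length q = n"
    using dist gdist_attained by metis
  then have "gdist G u w \<le> enat (m + n)"
    using gdist_le_length[of G u "p @ q" w] by auto
  then show ?thesis
    using dist by simp
qed simp_all

lemma gdist_le_ecc:
  assumes "finite (pverts G)" "u \<in> pverts G"
  shows "gdist G u v \<le> ecc G v"
  unfolding ecc_def using assms by (intro Max_ge) auto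

lemma burns_in_iff:
  "burns_in G k \<longleftrightarrow>
     (\<exists>v. (\<forall>i\<in>{1..k}. v i \<in> pverts G) \<and>
          (\<forall>u\<in>pverts G. \<exists>i\<in>{1..k}. gdist G u (v i) \<le> enat (k - i)))"
  unfolding burns_in_def gball_def by (intro ex_cong1 conj_cong) auto

lemma burning_number_le: "burns_in G k \<Longrightarrow> burning_number G \<le> k"
  unfolding burning_number_def by (rule Least_le)

lemma burning_number_empty:
  assumes "pverts G = {}"
  shows "burning_number G = 0"
  using burning_number_le[of G 0] assms by (simp add: burns_in_iff)

lemma burns_in_hom:
  assumes H: "pair_wf_digraph H" and hom: "digraph_hom G H f"
    and near: "\<And>x. x \<in> pverts H \<Longrightarrow> \<exists>u\<in>pverts G. gdist H x (f u) \<le> enat e"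
    and nonempty: "pverts G \<noteq> {}" and burns: "burns_in G k"
  shows "burns_in H (k + e)"
proof -
  obtain v where v: "\<And>i. i \<in> {1..k} \<Longrightarrow> v i \<in> pverts G"
    and cover: "\<And>u. u \<in> pverts G \<Longrightarrow> \<exists>i\<in>{1..k}. gdist G u (v i) \<le> enat (k - i)"
    using burns unfolding burns_in_iff by blast
  have "k \<ge> 1"
    using cover nonempty by fastforce
  \<comment> \<open>The last \<open>e\<close> fires are superfluous; they may be lit anywhere.\<close>
  define w where "w i = f (v (min i k))" for i
  have "w i \<in> pverts H" if "i \<in> {1..k + e}" for i
    using that hom v[of "min i k"] \<open>k \<ge> 1\<close> by (auto simp: w_def digraph_hom_def)
  moreover have "\<exists>i\<in>{1..k + e}. gdist H x (w i) \<le> enat (k + e - i)" if x: "x \<in> pverts H" for x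
  proof -
    obtain u where u: "u \<in> pverts G" and xu: "gdist H x (f u) \<le> enat e"
      using near[OF x] by blast
    obtain i where i: "i \<in> {1..k}" and uv: "gdist G u (v i) \<le> enat (k - i)"
      using cover[OF u] by blast
    have "gdist H x (f (v i)) \<le> gdist H x (f u) + gdist H (f u) (f (v i))"
      by (rule gdist_triangle[OF H])
    also have "\<dots> \<le> enat e + enat (k - i)"
      using xu order_trans[OF gdist_hom_le[OF hom] uv] by (rule add_mono)
    also have "\<dots> = enat (k + e - i)"
      using i by simp
    finally show ?thesis
      using i by (intro bexI[of _ i]) (auto simp: w_def)
  qed
  ultimately show ?thesis
    unfolding burns_in_iff by blast
qed

lemma burning_number_hom_le:
  assumes "finite (pverts G)" "pair_wf_digraph H" "digraph_hom G H f"
    and near: "\<And>x. x \<in> pverts H \<Longrightarrow> \<exists>u\<in>pverts G. gdist H x (f u) \<le> e"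
  shows "enat (burning_number H) \<le> enat (burning_number G) + e"
proof (cases e)
  case (enat n)
  show ?thesis
  proof (cases "pverts G = {}")
    case True
    then have "pverts H = {}"
      using near by blast
    then show ?thesis
      by (simp add: burning_number_empty flip: zero_enat_def)
  next
    case False
    have "burns_in H (burning_number G + n)"
      using assms(2,3) near[unfolded enat] False burns_in_burning_number[OF assms(1)]
      by (rule burns_in_hom)
    then show ?thesis
      using burning_number_le enat by simp
  qed
qed simp

lemma digraph_hom_rooted_product_cartesian_product:
  "r \<in> pverts H \<Longrightarrow> digraph_hom (rooted_product G H r) (cartesian_product G H) id"
  by (auto simp: digraph_hom_def rooted_product_def cartesian_product_def)

lemma digraph_hom_root:
  "r \<in> pverts H \<Longrightarrow> digraph_hom G (rooted_product G H r) (\<lambda>g. (g, r))"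
  by (auto simp: digraph_hom_def rooted_product_def)

lemma digraph_hom_fibre:
  "g \<in> pverts G \<Longrightarrow> digraph_hom H (rooted_product G H r) (Pair g)"
  by (auto simp: digraph_hom_def rooted_product_def)

lemma gdist_rooted_product_root_le_ecc:
  assumes "finite (pverts H)" "g \<in> pverts G" "h \<in> pverts H"
  shows "gdist (rooted_product G H r) (g, h) (g, r) \<le> ecc H r"
  using gdist_hom_le[OF digraph_hom_fibre[OF assms(2)]] gdist_le_ecc[OF assms(1,3)]
  by (rule order_trans)

theorem theorem1p2:
  fixes G :: "'a pair_pre_digraph" and H :: "'b pair_pre_digraph" and r :: 'b
  assumes "pair_graph G" and "pair_graph H" and "r \<in> pverts H"
  shows "burning_number (cartesian_product G H) \<le> burning_number (rooted_product G H r) \<and>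
         enat (burning_number (rooted_product G H r)) \<le> enat (burning_number G) + ecc H r"
proof
  let ?C = "cartesian_product G H" and ?R = "rooted_product G H r"
  interpret G: pair_graph G by fact
  interpret H: pair_graph H by fact
  interpret C: pair_graph ?C by (rule pair_graph_cartesian_product[OF assms(1,2)])
  interpret R: pair_graph ?R by (rule pair_graph_rooted_product[OF assms])
  have "\<exists>u\<in>pverts ?R. gdist ?C x (id u) \<le> 0" if "x \<in> pverts ?C" for x
    using that gdist_self[OF that] by (auto simp: rooted_product_def cartesian_product_def)
  with R.pair_finite_verts C.pair_wf_digraph
    digraph_hom_rooted_product_cartesian_product[OF assms(3)]
  have "enat (burning_number ?C) \<le> enat (burning_number ?R) + 0"
    by (rule burning_number_hom_le)
  then show "burning_number ?C \<le> burning_number ?R"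
    by simp
  have "\<exists>g\<in>pverts G. gdist ?R x (g, r) \<le> ecc H r" if "x \<in> pverts ?R" for x
    using that gdist_rooted_product_root_le_ecc[OF H.pair_finite_verts]
    by (fastforce simp: rooted_product_def)
  with G.pair_finite_verts R.pair_wf_digraph digraph_hom_root[OF assms(3)]
  show "enat (burning_number ?R) \<le> enat (burning_number G) + ecc H r"
    by (rule burning_number_hom_le)
qed

end
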